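(* Let $G=(V,E)$ be a connected graph on $n$ vertices. For any vertex subset $U=\{u_1,\ldots,u_m\}$ with $0<m<n$, writing $\overline{U}=V\setminus U$, $$\sum_{i=1}^{m+1} q_{n-i+1}(G)\leq \sum_{u\in U} d_u+\frac{\sum_{\overline{u}\in\overline{U}} d_{\overline{u}}+2|E[\overline{U}]|}{n-m}\leq \sum_{i=1}^{m+1} q_i(G).$$
   Context: $Q(G)=D+A$ is the signless Laplacian of $G$ (degree diagonal matrix plus adjacency matrix), with eigenvalues $q_1(G)\geq\cdots\geq q_n(G)$; $d_w$ is the degree of vertex $w$ in $G$; $E[\overline{U}]$ is the set of edges of $G$ with both endpoints in $\overline{U}$. *)

theory Defs
  imports
    "Graph_Theory.Digraph_Component"
    "Jordan_Normal_Form.Char_Poly"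
begin

text \<open>
  A finite simple undirected graph is \<^locale>\<open>graph\<close>: a finite symmetric digraph without loops
  and without parallel arcs, so every undirected edge is represented by two opposite arcs and the
  degree of a vertex is its \<^const>\<open>out_degree\<close>.

  Matrices are indexed by natural numbers, hence the matrices below depend on an enumeration
  \<open>vs\<close> of the vertices (a distinct list with \<open>set vs = verts G\<close>). Different enumerations give
  matrices that are conjugate by a permutation matrix, so the eigenvalues do not depend on it.
\<close>

definition degree_mat :: "('a, 'b) pre_digraph \<Rightarrow> 'a list \<Rightarrow> real mat" where
  "degree_mat G vs = mat (length vs) (length vs)
     (\<lambda>(i, j). if i = j then real (out_degree G (vs ! i)) else 0)"

definition adjacency_mat :: "('a, 'b) pre_digraph \<Rightarrow> 'a list \<Rightarrow> real mat" where
  "adjacency_mat G vs = mat (length vs) (length vs)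
     (\<lambda>(i, j). if vs ! i \<rightarrow>\<^bsub>G\<^esub> vs ! j then 1 else 0)"

definition signless_laplacian :: "('a, 'b) pre_digraph \<Rightarrow> 'a list \<Rightarrow> real mat" where
  "signless_laplacian G vs = degree_mat G vs + adjacency_mat G vs"

text \<open>
  The real eigenvalues of a square matrix, repeated according to algebraic multiplicity, in
  non-increasing order. For a symmetric real matrix of dimension \<open>n\<close> all roots of the
  characteristic polynomial are real, so the list has length \<open>n\<close>.
\<close>

definition eigenvalues_desc :: "real mat \<Rightarrow> real list" where
  "eigenvalues_desc A = rev (sorted_list_of_multiset (proots (char_poly A)))"

text \<open>The index is 1-based, as in $q_1(G) \geq \cdots \geq q_n(G)$.\<close>

definition q_eig :: "('a, 'b) pre_digraph \<Rightarrow> 'a list \<Rightarrow> nat \<Rightarrow> real" where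
  "q_eig G vs i = eigenvalues_desc (signless_laplacian G vs) ! (i - 1)"

definition edges_within :: "('a, 'b) pre_digraph \<Rightarrow> 'a set \<Rightarrow> 'a set set" where
  "edges_within G S = {{u, v} | u v. u \<in> S \<and> v \<in> S \<and> u \<rightarrow>\<^bsub>G\<^esub> v}"

end

theory Submission
  imports Defs "Jordan_Normal_Form.Schur_Decomposition"
begin

text \<open>
  The middle quantity is the sum of the values of the quadratic form of $Q(G)$ on the $m + 1$
  orthonormal vectors $e_u$ for $u \in U$ and $(n - m)^{-1/2} \mathbf{1}_{V \setminus U}$: the form
  is $d_u$ on $e_u$, and on $\mathbf{1}_{V \setminus U}$ it is the sum of the degrees plus twice
  the number of edges inside $V \setminus U$. By Ky Fan's principle, the sum of a real symmetric
  form over $k$ orthonormal vectors lies between the sums of the $k$ smallest and of the $k$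
  largest eigenvalues: expanded in an orthonormal eigenbasis it is a weighted sum of the eigenvalues
  in which every weight lies in $[0, 1]$ (Bessel) and the weights add up to $k$.
\<close>

section \<open>The spectral theorem for real symmetric matrices\<close>

text \<open>Over the complex numbers the characteristic polynomial splits, so a complex eigenvalue
  exists. Its Hermitian form is invariant under conjugation because the matrix is real and
  symmetric; this makes the eigenvalue real and hence a root of the real characteristic
  polynomial.\<close>

lemma real_symmetric_eigenvalue_exists:
  fixes A :: "real mat"
  assumes A: "A \<in> carrier_mat n n" and sym: "transpose_mat A = A" and n: "n > 0"
  shows "\<exists>e. eigenvalue A e"
proof -
  let ?B = "map_mat complex_of_real A"
  have B: "?B \<in> carrier_mat n n" using A by simp
  obtain as where as: "char_poly ?B = (\<Prod>a\<leftarrow>as. [:- a, 1:])" "length as = n"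
    using char_poly_factorized[OF B] by blast
  then obtain \<mu> where "\<mu> \<in> set as" using n by (cases as) auto
  then have root: "poly (char_poly ?B) \<mu> = 0"
    unfolding as by (simp add: poly_prod_list_zero_iff image_iff)
  then obtain v where "eigenvector ?B v \<mu>"
    using eigenvalue_root_char_poly[OF B] unfolding eigenvalue_def by blast
  then have v: "v \<in> carrier_vec n" and v0: "v \<noteq> 0\<^sub>v n" and ev: "?B *\<^sub>v v = \<mu> \<cdot>\<^sub>v v"
    using A unfolding eigenvector_def by auto
  have Aij: "A $$ (i, j) = A $$ (j, i)" if "i < n" "j < n" for i j
    using arg_cong[OF sym, of "\<lambda>M. M $$ (i, j)"] A that by simp
  have row: "(\<Sum>j<n. of_real (A $$ (i, j)) * v $ j) = \<mu> * v $ i" if i: "i < n" for i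
    using arg_cong[OF ev, of "\<lambda>w. w $ i"] A v i
    by (simp add: scalar_prod_def atLeast0LessThan)
  \<comment> \<open>\<open>N\<close> is the squared norm of \<open>v\<close> and \<open>S\<close> is
    the Hermitian form of the matrix at \<open>v\<close>. The eigenvector equation gives
    \<open>S = \<mu> * N\<close>, so \<open>\<mu>\<close> is real once both are real and
    \<open>N\<close> is nonzero.\<close>
  define N where "N = (\<Sum>i<n. cnj (v $ i) * v $ i)"
  define S where "S = (\<Sum>i<n. \<Sum>j<n. cnj (v $ i) * of_real (A $$ (i, j)) * v $ j)"
  have S: "S = \<mu> * N"
    unfolding S_def N_def sum_distrib_left
  proof (intro sum.cong refl)
    fix i assume "i \<in> {..<n}"
    then have "(\<Sum>j<n. cnj (v $ i) * (of_real (A $$ (i, j)) * v $ j)) = cnj (v $ i) * (\<mu> * v $ i)"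
      using row[of i] by (simp flip: sum_distrib_left)
    then show "(\<Sum>j<n. cnj (v $ i) * of_real (A $$ (i, j)) * v $ j) = \<mu> * (cnj (v $ i) * v $ i)"
      by (simp add: mult_ac)
  qed
  \<comment> \<open>Conjugation moves the bar to the other factor; exchanging the two summations and
    using symmetry of \<open>A\<close> restores \<open>S\<close>.\<close>
  have "cnj S = (\<Sum>i<n. \<Sum>j<n. cnj (v $ j) * of_real (A $$ (i, j)) * v $ i)"
    unfolding S_def by (simp add: mult_ac)
  also have "\<dots> = (\<Sum>i<n. \<Sum>j<n. cnj (v $ i) * of_real (A $$ (j, i)) * v $ j)"
    by (rule sum.swap)
  also have "\<dots> = S"
    unfolding S_def by (intro sum.cong refl) (simp add: Aij)
  finally have "cnj S = S" .
  moreover have N: "N = of_real (\<Sum>i<n. (cmod (v $ i))\<^sup>2)"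
    unfolding N_def by (simp only: complex_norm_square of_real_sum mult.commute)
  moreover have "N \<noteq> 0"
  proof -
    obtain i where i: "i < n" "v $ i \<noteq> 0"
      using v v0 by (metis carrier_vecD eq_vecI index_zero_vec)
    have "0 < (\<Sum>i<n. (cmod (v $ i))\<^sup>2)"
      by (rule sum_pos2[of _ i]) (use i in auto)
    then show ?thesis unfolding N by (simp only: of_real_eq_0_iff)
  qed
  ultimately have "cnj \<mu> = \<mu>"
    unfolding S by simp
  then have "\<mu> = of_real (Re \<mu>)"
    by (metis Reals_cnj_iff of_real_Re)
  then have "poly (map_poly of_real (char_poly A)) (complex_of_real (Re \<mu>)) = 0"
    using root by (simp add: of_real_hom.char_poly_hom[OF A])
  then have "poly (char_poly A) (Re \<mu>) = 0" by simp
  then show ?thesis using eigenvalue_root_char_poly[OF A] by blast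
qed

text \<open>An eigenvector is completed to a basis, orthogonalised by Gram-Schmidt and normalised;
  the results are the columns of \<open>W\<close>. This supplies the change of basis that splits off
  one eigenvalue in the induction for diagonalization.\<close>

lemma orthogonal_mat_with_eigenvector:
  fixes A :: "real mat"
  assumes A: "A \<in> carrier_mat n n" and ev: "eigenvalue A e"
  shows "\<exists>W \<in> carrier_mat n n. transpose_mat W * W = 1\<^sub>m n \<and> A *\<^sub>v col W 0 = e \<cdot>\<^sub>v col W 0"
proof -
  have n: "n > 0" using eigenvalue_imp_nonzero_dim[OF A ev] .
  obtain v where v: "v \<in> carrier_vec n" and v0: "v \<noteq> 0\<^sub>v n" and Av: "A *\<^sub>v v = e \<cdot>\<^sub>v v"
    using ev A unfolding eigenvalue_def eigenvector_def by auto
  interpret cof_vec_space n "TYPE(real)" .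
  define b where "b = basis_completion v"
  define ws where "ws = gram_schmidt n b"
  note bc = basis_completion[OF v v0, folded b_def]
  note gs = gram_schmidt_result[OF bc(2) bc(4) bc(5) ws_def]
  have len: "length ws = n" using gs bc by simp
  have ws: "ws ! i \<in> carrier_vec n" if "i < n" for i
    using gs that len by (metis nth_mem subsetD)
  obtain vs where "b = v # vs" using bc n by (cases b) auto
  \<comment> \<open>Gram-Schmidt leaves the first basis vector unchanged, so the eigenvector
    survives as the first of the orthogonal vectors.\<close>
  then have "hd ws = v" unfolding ws_def using gram_schmidt_hd[OF v] by simp
  then have ws0: "ws ! 0 = v" using len n by (metis hd_conv_nth length_0_conv less_irrefl)
  have conj: "conjugate w = w" for w :: "real vec"
    by (rule eq_vecI) auto
  have orth: "ws ! i \<bullet> ws ! j = 0 \<longleftrightarrow> i \<noteq> j" if "i < n" "j < n" for i j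
    using corthogonalD[OF gs(2), of i j] that len by (simp add: conj)
  define c where "c i = 1 / sqrt (ws ! i \<bullet> ws ! i)" for i
  define W where "W = mat_of_cols n (map (\<lambda>i. c i \<cdot>\<^sub>v ws ! i) [0..<n])"
  have W: "W \<in> carrier_mat n n" unfolding W_def by auto
  have col: "col W i = c i \<cdot>\<^sub>v ws ! i" if "i < n" for i
    unfolding W_def using that ws by (subst col_mat_of_cols) auto
  have "transpose_mat W * W = 1\<^sub>m n"
  proof (rule eq_matI)
    fix i j assume "i < dim_row (1\<^sub>m n :: real mat)" "j < dim_col (1\<^sub>m n :: real mat)"
    then have i: "i < n" and j: "j < n" by auto
    have pos: "ws ! i \<bullet> ws ! i > 0"
    proof -
      have "ws ! i \<bullet> ws ! i \<ge> 0" unfolding scalar_prod_def by (intro sum_nonneg) simp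
      then show ?thesis using orth[OF i i] by simp
    qed
    have "(transpose_mat W * W) $$ (i, j) = col W i \<bullet> col W j"
      using W i j by simp
    also have "\<dots> = c i * (c j * (ws ! i \<bullet> ws ! j))"
      using ws[OF i] ws[OF j] by (simp add: col i j)
    also have "\<dots> = 1\<^sub>m n $$ (i, j)"
      using orth[OF i j] i j pos by (cases "i = j") (auto simp: c_def)
    finally show "(transpose_mat W * W) $$ (i, j) = 1\<^sub>m n $$ (i, j)" .
  qed (use W in auto)
  moreover have "A *\<^sub>v col W 0 = e \<cdot>\<^sub>v col W 0"
    using A v Av n by (simp add: col ws0 mult_mat_vec[OF A v] smult_smult_assoc mult.commute)
  ultimately show ?thesis using W by blast
qed

text \<open>Deflation, by induction on the dimension: in an orthonormal basis starting with an
  eigenvector the matrix becomes block diagonal, with the eigenvalue in one block and a smaller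
  symmetric matrix in the other, to which the induction hypothesis applies.\<close>

theorem real_symmetric_orthogonal_diagonalization:
  fixes A :: "real mat"
  assumes "A \<in> carrier_mat n n" and "transpose_mat A = A"
  shows "\<exists>P D. P \<in> carrier_mat n n \<and> D \<in> carrier_mat n n \<and> diagonal_mat D
           \<and> transpose_mat P * P = 1\<^sub>m n \<and> A = P * D * transpose_mat P"
  using assms
proof (induction n arbitrary: A)
  case 0
  then show ?case
    by (intro exI[of _ "1\<^sub>m 0"] exI[of _ "0\<^sub>m 0 0"]) (auto simp: diagonal_mat_def)
next
  case (Suc n A)
  note A = Suc.prems(1) and sym = Suc.prems(2)
  obtain e where "eigenvalue A e"
    using real_symmetric_eigenvalue_exists[OF A sym] by auto
  then obtain W where W: "W \<in> carrier_mat (Suc n) (Suc n)"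
    and WW: "transpose_mat W * W = 1\<^sub>m (Suc n)" and ev: "A *\<^sub>v col W 0 = e \<cdot>\<^sub>v col W 0"
    using orthogonal_mat_with_eigenvector[OF A] by blast
  let ?Wt = "transpose_mat W"
  have Wt: "?Wt \<in> carrier_mat (Suc n) (Suc n)" using W by simp
  have WW': "W * ?Wt = 1\<^sub>m (Suc n)"
    using mat_mult_left_right_inverse[OF Wt W WW] .
  define A' where "A' = ?Wt * A * W"
  have A': "A' \<in> carrier_mat (Suc n) (Suc n)" using A W unfolding A'_def by auto
  have symA': "transpose_mat A' = A'"
    unfolding A'_def using A W sym
    by (simp add: transpose_mult[of _ "Suc n" "Suc n" _ "Suc n"]
        assoc_mult_mat[of _ "Suc n" "Suc n" _ "Suc n" _ "Suc n"])
  have A'ij: "A' $$ (i, j) = A' $$ (j, i)" if "i < Suc n" "j < Suc n" for i j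
    using arg_cong[OF symA', of "\<lambda>M. M $$ (i, j)"] A' that by simp
  \<comment> \<open>Since column 0 of \<open>W\<close> is an eigenvector, this column is
    \<open>e\<close> times column 0 of \<open>transpose_mat W * W\<close>, the identity.\<close>
  have col0: "A' $$ (i, 0) = (if i = 0 then e else 0)" if i: "i < Suc n" for i
  proof -
    have "A' $$ (i, 0) = (?Wt * (A * W)) $$ (i, 0)"
      unfolding A'_def using A W by simp
    also have "\<dots> = col W i \<bullet> (A *\<^sub>v col W 0)"
      using A W i by (simp add: mult_mat_vec_def times_mat_def)
    also have "\<dots> = e * (?Wt * W) $$ (i, 0)"
      unfolding ev using W i by simp
    finally show ?thesis unfolding WW using i by simp
  qed
  define A3 where "A3 = mat n n (\<lambda>(i, j). A' $$ (Suc i, Suc j))"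
  have A3: "A3 \<in> carrier_mat n n" unfolding A3_def by simp
  have "transpose_mat A3 = A3"
    unfolding A3_def by (rule eq_matI) (auto simp: A'ij)
  then obtain P D where P: "P \<in> carrier_mat n n" and D: "D \<in> carrier_mat n n"
    and diag: "diagonal_mat D" and PP: "transpose_mat P * P = 1\<^sub>m n"
    and A3eq: "A3 = P * D * transpose_mat P"
    using Suc.IH[OF A3] by blast
  let ?blk = "\<lambda>X Y. four_block_mat X (0\<^sub>m 1 n) (0\<^sub>m n 1) Y"
  let ?E = "mat 1 1 (\<lambda>_. e)"
  \<comment> \<open>Symmetry of \<open>A'\<close> carries the zeros of its first column over to its
    first row.\<close>
  have A'blk: "A' = ?blk ?E A3"
  proof (rule eq_matI)
    fix i j assume "i < dim_row (?blk ?E A3)" "j < dim_col (?blk ?E A3)"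
    then have "i < Suc n" "j < Suc n" using A3 by auto
    then show "A' $$ (i, j) = ?blk ?E A3 $$ (i, j)"
      using A3 col0[of i] col0[of j] A'ij[of 0 j]
      by (cases i; cases j) (auto simp: A3_def)
  qed (use A' A3 in auto)
  define P' where "P' = ?blk (1\<^sub>m 1) P"
  define D' where "D' = ?blk ?E D"
  have P': "P' \<in> carrier_mat (Suc n) (Suc n)"
    using four_block_carrier_mat[of "1\<^sub>m 1" 1 1 P n n] P unfolding P'_def by simp
  have D': "D' \<in> carrier_mat (Suc n) (Suc n)"
    using four_block_carrier_mat[of ?E 1 1 D n n] D unfolding D'_def by simp
  have mult: "?blk X Y * ?blk X' Y' = ?blk (X * X') (Y * Y')"
    if "X \<in> carrier_mat 1 1" "X' \<in> carrier_mat 1 1" "Y \<in> carrier_mat n n" "Y' \<in> carrier_mat n n"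
    for X X' Y Y' :: "real mat"
    using that by (subst mult_four_block_mat[of _ 1 1 _ n _ n _ _ 1 _ n]) auto
  have P't: "transpose_mat P' = ?blk (1\<^sub>m 1) (transpose_mat P)"
    unfolding P'_def using P by (subst transpose_four_block_mat[of _ 1 1 _ n _ n]) auto
  have PP': "transpose_mat P' * P' = 1\<^sub>m (Suc n)"
    unfolding P't unfolding P'_def using P by (subst mult) (auto simp: PP)
  have P'D': "P' * D' = ?blk ?E (P * D)"
    unfolding P'_def D'_def using P D by (subst mult) auto
  have A'eq: "A' = P' * D' * transpose_mat P'"
    unfolding P'D' P't A'blk A3eq using P D by (subst mult) auto
  have diag': "diagonal_mat D'"
    using diag D unfolding D'_def diagonal_mat_def by auto
  \<comment> \<open>The diagonalizing matrix first passes to the basis \<open>W\<close> and then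
    diagonalizes the lower block, leaving the eigenvector fixed.\<close>
  define R where "R = W * P'"
  have R: "R \<in> carrier_mat (Suc n) (Suc n)" using W P' unfolding R_def by simp
  note assoc = assoc_mult_mat[of _ "Suc n" "Suc n" _ "Suc n" _ "Suc n"]
  have Rt: "transpose_mat R = transpose_mat P' * ?Wt"
    unfolding R_def by (rule transpose_mult[OF W P'])
  have P't': "transpose_mat P' \<in> carrier_mat (Suc n) (Suc n)" using P' by simp
  have "transpose_mat R * R = transpose_mat P' * ((?Wt * W) * P')"
    unfolding Rt unfolding R_def using W Wt P' P't' by (simp add: assoc)
  also have "\<dots> = 1\<^sub>m (Suc n)" using P' by (simp add: WW PP')
  finally have RR: "transpose_mat R * R = 1\<^sub>m (Suc n)" .
  have "R * D' * transpose_mat R = W * A' * ?Wt"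
    unfolding Rt A'eq unfolding R_def using W Wt P' P't' D' by (simp add: assoc)
  also have "\<dots> = (W * ?Wt) * A * (W * ?Wt)"
    unfolding A'_def using W Wt A by (simp add: assoc)
  also have "\<dots> = A" using A by (simp add: WW')
  finally have "A = R * D' * transpose_mat R" by simp
  then show ?case using R D' diag' RR by blast
qed

lemma proots_prod_linear_factors:
  "proots (\<Prod>a\<leftarrow>as. [:- a, 1:]) = mset (as :: 'a :: idom list)"
proof (induction as)
  case (Cons a as)
  have "(\<Prod>a\<leftarrow>as. [:- a, 1:]) \<noteq> 0" by (auto simp: prod_list_zero_iff)
  then show ?case
    using Cons.IH by (simp add: proots_mult del: mult_pCons_left)
qed simp

text \<open>The diagonalization in coordinates, ready for manipulation of finite sums:
  \<open>v k\<close> is column \<open>k\<close> of the orthogonal matrix and \<open>d k\<close> its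
  eigenvalue. The two orthogonality relations are orthonormality and completeness. Eigenvalues agree
  only as multisets because the diagonal comes in arbitrary order.\<close>

lemma real_symmetric_eigenbasis:
  fixes A :: "real mat"
  assumes A: "A \<in> carrier_mat n n" and sym: "transpose_mat A = A"
  obtains d :: "nat \<Rightarrow> real" and v :: "nat \<Rightarrow> nat \<Rightarrow> real"
  where "\<And>a b. a < n \<Longrightarrow> b < n \<Longrightarrow> A $$ (a, b) = (\<Sum>k<n. d k * v k a * v k b)"
    and "\<And>k l. k < n \<Longrightarrow> l < n \<Longrightarrow> (\<Sum>a<n. v k a * v l a) = (if k = l then 1 else 0)"
    and "\<And>a b. a < n \<Longrightarrow> b < n \<Longrightarrow> (\<Sum>k<n. v k a * v k b) = (if a = b then 1 else 0)"
    and "mset (eigenvalues_desc A) = mset (map d [0..<n])"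
proof -
  obtain P D where P: "P \<in> carrier_mat n n" and D: "D \<in> carrier_mat n n"
    and diag: "diagonal_mat D" and PP: "transpose_mat P * P = 1\<^sub>m n"
    and Aeq: "A = P * D * transpose_mat P"
    using real_symmetric_orthogonal_diagonalization[OF A sym] by blast
  have PP': "P * transpose_mat P = 1\<^sub>m n"
    using mat_mult_left_right_inverse[OF _ P PP] P by simp
  have PD: "(P * D) $$ (a, k) = D $$ (k, k) * P $$ (a, k)" if "a < n" "k < n" for a k
  proof -
    have "(P * D) $$ (a, k) = (\<Sum>l<n. P $$ (a, l) * D $$ (l, k))"
      using P D that by (simp add: scalar_prod_def atLeast0LessThan)
    also have "\<dots> = (\<Sum>l<n. if l = k then D $$ (k, k) * P $$ (a, k) else 0)"
      using diag D that by (intro sum.cong refl) (auto simp: diagonal_mat_def)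
    finally show ?thesis using that by simp
  qed
  have mult_transpose: "(M * transpose_mat P) $$ (a, b) = (\<Sum>k<n. M $$ (a, k) * P $$ (b, k))"
    if "M \<in> carrier_mat n n" "a < n" "b < n" for M a b
    using that P by (simp add: scalar_prod_def atLeast0LessThan)
  show thesis
  proof (rule that[of "\<lambda>k. D $$ (k, k)" "\<lambda>k a. P $$ (a, k)"])
    fix a b assume ab: "a < n" "b < n"
    have "A $$ (a, b) = (\<Sum>k<n. (P * D) $$ (a, k) * P $$ (b, k))"
      unfolding Aeq using P D ab by (intro mult_transpose) auto
    then show "A $$ (a, b) = (\<Sum>k<n. D $$ (k, k) * P $$ (a, k) * P $$ (b, k))"
      using ab by (simp add: PD)
    show "(\<Sum>k<n. P $$ (a, k) * P $$ (b, k)) = (if a = b then 1 else 0)"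
      using arg_cong[OF PP', of "\<lambda>M. M $$ (a, b)"] P ab
      by (simp add: scalar_prod_def atLeast0LessThan)
  next
    fix k l assume kl: "k < n" "l < n"
    show "(\<Sum>a<n. P $$ (a, k) * P $$ (a, l)) = (if k = l then 1 else 0)"
      using arg_cong[OF PP, of "\<lambda>M. M $$ (k, l)"] P kl
      by (simp add: scalar_prod_def atLeast0LessThan)
  next
    \<comment> \<open>Similarity preserves the characteristic polynomial, and that of
      \<open>D\<close> has the diagonal entries as its roots with multiplicity.\<close>
    have "similar_mat A D"
      using A D P PP PP' Aeq by (intro similar_matI[of _ _ P "transpose_mat P" n]) auto
    then have "char_poly A = char_poly D" by (rule char_poly_similar)
    also have "\<dots> = (\<Prod>a\<leftarrow>diag_mat D. [:- a, 1:])"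
      using diag D by (intro char_poly_upper_triangular[OF D]) (auto simp: diagonal_mat_def)
    finally have "proots (char_poly A) = mset (diag_mat D)"
      by (simp add: proots_prod_linear_factors)
    then show "mset (eigenvalues_desc A) = mset (map (\<lambda>k. D $$ (k, k)) [0..<n])"
      using D by (simp add: eigenvalues_desc_def diag_mat_def)
  qed
qed

section \<open>Weighted sums against the largest and smallest entries of a sorted list\<close>

lemma eigenvalues_desc_sorted: "sorted_wrt (\<ge>) (eigenvalues_desc A)"
  by (simp add: eigenvalues_desc_def sorted_wrt_rev)

text \<open>With \<open>t\<close> the \<open>k\<close>-th largest value, both sides are compared with
  \<open>k * t\<close> plus the sum of the positive parts of \<open>d j - t\<close>.\<close>

lemma weighted_sum_le_sum_largest:
  fixes d w :: "nat \<Rightarrow> real" and xs :: "real list"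
  assumes sorted: "sorted_wrt (\<ge>) xs" and mset: "mset xs = mset (map d [0..<n])"
    and w: "\<And>j. j < n \<Longrightarrow> 0 \<le> w j \<and> w j \<le> 1"
    and k: "(\<Sum>j<n. w j) = real k"
  shows "(\<Sum>j<n. d j * w j) \<le> (\<Sum>i<k. xs ! i)"
proof (cases "k = 0")
  case True
  \<comment> \<open>For \<open>k = 0\<close> there is no threshold entry; nonnegative weights with
    sum 0 all vanish.\<close>
  then have "\<forall>j\<in>{..<n}. w j = 0"
    using k w sum_nonneg_eq_0_iff[of "{..<n}" w] by auto
  then show ?thesis using True by simp
next
  case False
  have len: "length xs = n" using mset by (metis diff_zero length_map length_upt mset_eq_length)
  have "real k \<le> (\<Sum>j<n. 1)" unfolding k[symmetric] using w by (intro sum_mono) auto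
  \<comment> \<open>Weights of at most 1 force \<open>k \<le> n\<close>, so the \<open>k\<close>-th
    largest entry, at index \<open>k - 1\<close>, exists.\<close>
  then have kn: "k \<le> n" by simp
  define t where "t = xs ! (k - 1)"
  define f where "f x = max (x - t) 0" for x
  have "(\<Sum>j<n. d j * w j) = (\<Sum>j<n. (d j - t) * w j) + t * (\<Sum>j<n. w j)"
    by (simp add: sum_distrib_left algebra_simps flip: sum.distrib)
  also have "(\<Sum>j<n. (d j - t) * w j) \<le> (\<Sum>j<n. f (d j))"
  proof (rule sum_mono)
    fix j assume "j \<in> {..<n}"
    then have "0 \<le> w j" "w j \<le> 1" using w by auto
    then show "(d j - t) * w j \<le> f (d j)"
      unfolding f_def by (smt (verit) mult_left_le mult_nonneg_nonneg mult_nonpos_nonneg)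
  qed
  \<comment> \<open>A sum of \<open>f\<close> over all values depends only on their multiset, which
    allows passing from \<open>d\<close> to the sorted list.\<close>
  also have "(\<Sum>j<n. f (d j)) = sum_mset (image_mset f (mset (map d [0..<n])))"
    by (simp add: sum_mset_sum_list sum_list_sum_nth atLeast0LessThan flip: mset_map)
  also have "\<dots> = sum_mset (image_mset f (mset xs))" by (simp only: mset)
  also have "\<dots> = (\<Sum>i<n. f (xs ! i))"
    by (simp add: sum_mset_sum_list sum_list_sum_nth len atLeast0LessThan flip: mset_map)
  also have "\<dots> = (\<Sum>i<k. f (xs ! i)) + (\<Sum>i\<in>{k..<n}. f (xs ! i))"
    using kn by (simp add: sum.atLeastLessThan_concat flip: atLeast0LessThan)
  also have "(\<Sum>i\<in>{k..<n}. f (xs ! i)) = 0"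
  proof (intro sum.neutral ballI)
    fix i assume "i \<in> {k..<n}"
    then have "k - 1 < i" "i < length xs" using False len by auto
    then have "xs ! (k - 1) \<ge> xs ! i"
      using sorted_wrt_nth_less[OF sorted] by blast
    then show "f (xs ! i) = 0" by (simp add: f_def t_def)
  qed
  also have "(\<Sum>i<k. f (xs ! i)) = (\<Sum>i<k. xs ! i - t)"
  proof (intro sum.cong refl)
    fix i assume "i \<in> {..<k}"
    then have "i = k - 1 \<or> xs ! i \<ge> xs ! (k - 1)"
      using sorted_wrt_nth_less[OF sorted, of i "k - 1"] kn len by fastforce
    then show "f (xs ! i) = xs ! i - t" by (auto simp: f_def t_def)
  qed
  finally show ?thesis by (simp add: k sum_subtractf mult.commute)
qed

text \<open>The upper bound applied to the negated values with the same weights: negating and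
  reversing a non-increasing list gives a non-increasing list, whose first \<open>k\<close> entries
  are the negated last \<open>k\<close> entries of \<open>xs\<close>.\<close>

lemma weighted_sum_ge_sum_smallest:
  fixes d w :: "nat \<Rightarrow> real" and xs :: "real list"
  assumes sorted: "sorted_wrt (\<ge>) xs" and mset: "mset xs = mset (map d [0..<n])"
    and w: "\<And>j. j < n \<Longrightarrow> 0 \<le> w j \<and> w j \<le> 1"
    and k: "(\<Sum>j<n. w j) = real k"
  shows "(\<Sum>i<k. xs ! (n - 1 - i)) \<le> (\<Sum>j<n. d j * w j)"
proof -
  let ?ys = "map uminus (rev xs)"
  have len: "length xs = n" using mset by (metis diff_zero length_map length_upt mset_eq_length)
  have "real k \<le> (\<Sum>j<n. 1)" unfolding k[symmetric] using w by (intro sum_mono) auto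
  then have kn: "k \<le> n" by simp
  have "sorted_wrt (\<ge>) ?ys"
    using sorted by (simp add: sorted_wrt_map sorted_wrt_rev)
  moreover have "mset ?ys = mset (map (\<lambda>j. - d j) [0..<n])"
    using mset by (simp add: multiset.map_comp o_def flip: image_mset.compositionality)
  ultimately have "(\<Sum>j<n. - d j * w j) \<le> (\<Sum>i<k. ?ys ! i)"
    using w k by (rule weighted_sum_le_sum_largest)
  also have "\<dots> = (\<Sum>i<k. - (xs ! (n - 1 - i)))"
    using kn len by (intro sum.cong refl) (auto simp: rev_nth)
  finally show ?thesis by (simp add: sum_negf)
qed

section \<open>Bessel's inequality and Ky Fan's principle\<close>

text \<open>With \<open>y\<close> the orthogonal projection of \<open>v\<close> onto the span of the
  \<open>x i\<close>, both the inner product of \<open>v\<close> with \<open>y\<close> and the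
  squared norm of \<open>y\<close> equal the sum of the squared coefficients \<open>c i\<close>.
  Expanding the nonnegative squared norm of \<open>v - y\<close> gives the bound.\<close>

lemma bessel_inequality_sum:
  fixes x :: "'i \<Rightarrow> nat \<Rightarrow> real" and v :: "nat \<Rightarrow> real"
  assumes fin: "finite I"
    and orth: "\<And>i j. i \<in> I \<Longrightarrow> j \<in> I \<Longrightarrow> (\<Sum>a<n. x i a * x j a) = (if i = j then 1 else 0)"
  shows "(\<Sum>i\<in>I. (\<Sum>a<n. x i a * v a)\<^sup>2) \<le> (\<Sum>a<n. (v a)\<^sup>2)"
proof -
  define c where "c i = (\<Sum>a<n. x i a * v a)" for i
  define y where "y a = (\<Sum>i\<in>I. c i * x i a)" for a
  have vy: "(\<Sum>a<n. v a * y a) = (\<Sum>i\<in>I. (c i)\<^sup>2)"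
  proof -
    have "(\<Sum>a<n. v a * y a) = (\<Sum>a<n. \<Sum>i\<in>I. c i * (x i a * v a))"
      unfolding y_def by (simp add: sum_distrib_left mult_ac)
    also have "\<dots> = (\<Sum>i\<in>I. c i * c i)"
      by (subst sum.swap) (simp add: c_def flip: sum_distrib_left)
    finally show ?thesis by (simp add: power2_eq_square)
  qed
  have yy: "(\<Sum>a<n. y a * y a) = (\<Sum>i\<in>I. (c i)\<^sup>2)"
  proof -
    have "(\<Sum>a<n. y a * y a) = (\<Sum>a<n. \<Sum>i\<in>I. \<Sum>j\<in>I. c i * c j * (x i a * x j a))"
      unfolding y_def by (simp add: sum_product mult_ac)
    also have "\<dots> = (\<Sum>i\<in>I. \<Sum>a<n. \<Sum>j\<in>I. c i * c j * (x i a * x j a))"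
      by (rule sum.swap)
    also have "\<dots> = (\<Sum>i\<in>I. \<Sum>j\<in>I. \<Sum>a<n. c i * c j * (x i a * x j a))"
      by (intro sum.cong refl sum.swap)
    also have "\<dots> = (\<Sum>i\<in>I. \<Sum>j\<in>I. if i = j then c i * c j else 0)"
      by (intro sum.cong refl) (simp add: orth flip: sum_distrib_left)
    also have "\<dots> = (\<Sum>i\<in>I. (c i)\<^sup>2)"
      using fin by (simp add: power2_eq_square)
    finally show ?thesis .
  qed
  have "0 \<le> (\<Sum>a<n. (v a - y a)\<^sup>2)" by (intro sum_nonneg) simp
  also have "\<dots> = (\<Sum>a<n. (v a)\<^sup>2) - 2 * (\<Sum>a<n. v a * y a) + (\<Sum>a<n. y a * y a)"
    by (simp add: power2_eq_square algebra_simps sum.distrib sum_subtractf sum_distrib_left)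
  finally show ?thesis unfolding vy yy c_def by simp
qed

text \<open>The weight \<open>w k\<close> of an eigenvalue is the squared length of the projection
  of its eigenvector onto the span of the \<open>x i\<close>. The index type is left arbitrary so
  that the test vectors can be indexed by whatever labels them naturally.\<close>

theorem ky_fan:
  fixes A :: "real mat" and x :: "'i \<Rightarrow> nat \<Rightarrow> real"
  assumes A: "A \<in> carrier_mat n n" and sym: "transpose_mat A = A" and fin: "finite I"
    and orth: "\<And>i j. i \<in> I \<Longrightarrow> j \<in> I \<Longrightarrow> (\<Sum>a<n. x i a * x j a) = (if i = j then 1 else 0)"
  defines "q \<equiv> \<Sum>i\<in>I. \<Sum>a<n. \<Sum>b<n. A $$ (a, b) * x i a * x i b"
  shows "q \<le> (\<Sum>l<card I. eigenvalues_desc A ! l)"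
    and "(\<Sum>l<card I. eigenvalues_desc A ! (n - 1 - l)) \<le> q"
proof -
  obtain d v where Aab: "\<And>a b. a < n \<Longrightarrow> b < n \<Longrightarrow> A $$ (a, b) = (\<Sum>k<n. d k * v k a * v k b)"
    and v1: "\<And>k l. k < n \<Longrightarrow> l < n \<Longrightarrow> (\<Sum>a<n. v k a * v l a) = (if k = l then 1 else 0)"
    and v2: "\<And>a b. a < n \<Longrightarrow> b < n \<Longrightarrow> (\<Sum>k<n. v k a * v k b) = (if a = b then 1 else 0)"
    and ms: "mset (eigenvalues_desc A) = mset (map d [0..<n])"
    using real_symmetric_eigenbasis[OF A sym] by blast
  define w where "w k = (\<Sum>i\<in>I. (\<Sum>a<n. x i a * v k a)\<^sup>2)" for k
  \<comment> \<open>Used with two coefficient families: the constant 1, where completeness gives the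
    total weight, and \<open>d\<close>, where the spectral decomposition gives the form
    itself.\<close>
  have expand: "(\<Sum>k<n. e k * (\<Sum>a<n. x i a * v k a)\<^sup>2)
      = (\<Sum>a<n. \<Sum>b<n. (\<Sum>k<n. e k * v k a * v k b) * x i a * x i b)" for e i
  proof -
    have "(\<Sum>k<n. e k * (\<Sum>a<n. x i a * v k a)\<^sup>2)
        = (\<Sum>k<n. \<Sum>a<n. \<Sum>b<n. e k * v k a * v k b * x i a * x i b)"
      by (simp add: power2_eq_square sum_product sum_distrib_left mult_ac)
    also have "\<dots> = (\<Sum>a<n. \<Sum>k<n. \<Sum>b<n. e k * v k a * v k b * x i a * x i b)"
      by (rule sum.swap)
    also have "\<dots> = (\<Sum>a<n. \<Sum>b<n. \<Sum>k<n. e k * v k a * v k b * x i a * x i b)"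
      by (intro sum.cong refl sum.swap)
    finally show ?thesis by (simp add: sum_distrib_right)
  qed
  have "(\<Sum>k<n. w k) = (\<Sum>i\<in>I. \<Sum>k<n. 1 * (\<Sum>a<n. x i a * v k a)\<^sup>2)"
    unfolding w_def by (subst sum.swap) simp
  also have "\<dots> = (\<Sum>i\<in>I. \<Sum>a<n. \<Sum>b<n. if a = b then x i a * x i b else 0)"
    unfolding expand by (intro sum.cong refl) (simp add: v2)
  also have "\<dots> = (\<Sum>i\<in>I. \<Sum>a<n. x i a * x i a)"
    by simp
  also have "\<dots> = real (card I)" using orth by simp
  finally have wsum: "(\<Sum>k<n. w k) = real (card I)" .
  \<comment> \<open>Bessel's inequality for the unit vector \<open>v k\<close> bounds its weight by
    1.\<close>
  have w: "0 \<le> w k \<and> w k \<le> 1" if "k < n" for k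
    using bessel_inequality_sum[where v = "v k", OF fin orth] v1[OF that that]
    unfolding w_def by (auto intro!: sum_nonneg simp: power2_eq_square)
  have "q = (\<Sum>i\<in>I. \<Sum>k<n. d k * (\<Sum>a<n. x i a * v k a)\<^sup>2)"
    unfolding expand q_def by (intro sum.cong refl) (simp add: Aab)
  also have "\<dots> = (\<Sum>k<n. d k * w k)"
    unfolding w_def by (subst sum.swap) (simp add: sum_distrib_left)
  finally have q: "q = (\<Sum>k<n. d k * w k)" .
  show "q \<le> (\<Sum>l<card I. eigenvalues_desc A ! l)"
    unfolding q by (rule weighted_sum_le_sum_largest[OF eigenvalues_desc_sorted ms w wsum])
  show "(\<Sum>l<card I. eigenvalues_desc A ! (n - 1 - l)) \<le> q"
    unfolding q by (rule weighted_sum_ge_sum_smallest[OF eigenvalues_desc_sorted ms w wsum])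
qed

section \<open>The signless Laplacian on the test vectors\<close>

text \<open>The map from ordered adjacent pairs to unordered edges has fibres of size exactly two:
  symmetry of the graph supplies the reversed pair, and the absence of loops makes it
  different.\<close>

lemma (in graph) card_adjacent_pairs:
  assumes "finite S"
  shows "card {p \<in> S \<times> S. p \<in> arcs_ends G} = 2 * card (edges_within G S)"
proof -
  define R where "R = {p \<in> S \<times> S. p \<in> arcs_ends G}"
  define f :: "'a \<times> 'a \<Rightarrow> 'a set" where "f p = {fst p, snd p}" for p
  have fin: "finite R" unfolding R_def using assms by auto
  have img: "f ` R = edges_within G S"
  proof (intro equalityI subsetI)
    fix e assume "e \<in> f ` R"
    then show "e \<in> edges_within G S" unfolding f_def R_def edges_within_def by auto blast
  next
    fix e assume "e \<in> edges_within G S"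
    then obtain u v where "e = f (u, v)" "(u, v) \<in> R"
      unfolding edges_within_def R_def f_def by auto
    then show "e \<in> f ` R" by blast
  qed
  have fib: "card {p \<in> R. f p = e} = 2" if "e \<in> f ` R" for e
  proof -
    obtain u v where uv: "(u, v) \<in> R" "e = {u, v}" using \<open>e \<in> f ` R\<close> by (auto simp: f_def)
    then have "(v, u) \<in> R" "u \<noteq> v"
      unfolding R_def using graph_symmetric adj_not_same by auto
    then have "{p \<in> R. f p = e} = {(u, v), (v, u)}"
      using uv by (auto simp: f_def doubleton_eq_iff)
    then show ?thesis using \<open>u \<noteq> v\<close> by simp
  qed
  have "card R = (\<Sum>e\<in>f ` R. card {p \<in> R. f p = e})"
    using sum.image_gen[OF fin, of "\<lambda>_. 1 :: nat" f] by simp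
  also have "\<dots> = 2 * card (f ` R)" using fib by simp
  finally show ?thesis by (simp only: img R_def[symmetric])
qed

lemma signless_laplacian_index:
  assumes "distinct vs" "a < length vs" "b < length vs"
  shows "signless_laplacian G vs $$ (a, b)
     = (if a = b then real (out_degree G (vs ! a)) else 0) + (if (vs ! a, vs ! b) \<in> arcs_ends G then 1 else 0)"
  using assms by (simp add: signless_laplacian_def degree_mat_def adjacency_mat_def)

theorem theorem4p1:
  fixes G :: "('a, 'b) pre_digraph" and vs :: "'a list" and U :: "'a set" and n m :: nat
  assumes "Digraph.graph G"
    and "Digraph_Component.connected G"
    and "card (verts G) = n"
    and "distinct vs" and "set vs = verts G"
    and "U \<subseteq> verts G" and "card U = m" and "0 < m" and "m < n"
  shows "(\<Sum>i = 1..m + 1. q_eig G vs (n - i + 1))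
           \<le> (\<Sum>u\<in>U. real (out_degree G u))
              + ((\<Sum>u\<in>verts G - U. real (out_degree G u))
                  + 2 * real (card (edges_within G (verts G - U)))) / (real n - real m)
       \<and> (\<Sum>u\<in>U. real (out_degree G u))
              + ((\<Sum>u\<in>verts G - U. real (out_degree G u))
                  + 2 * real (card (edges_within G (verts G - U)))) / (real n - real m)
           \<le> (\<Sum>i = 1..m + 1. q_eig G vs i)"
proof -
  interpret graph G by fact
  let ?A = "signless_laplacian G vs" and ?V = "verts G - U"
  \<comment> \<open>Matrix indices are positions in \<open>vs\<close>; \<open>T\<close> and
    \<open>T'\<close> are the positions of the vertices in \<open>U\<close> and in its
    complement.\<close>
  define T where "T = {a. a < n \<and> vs ! a \<in> U}"
  define T' where "T' = {a. a < n \<and> vs ! a \<notin> U}"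
  have len: "length vs = n" using assms(3,4,5) distinct_card by fastforce
  have bij: "bij_betw ((!) vs) {..<n} (verts G)"
    using bij_betw_nth[OF \<open>distinct vs\<close>] len assms(5) by blast
  have bijT: "bij_betw ((!) vs) T U"
    using bij_betw_subset[OF bij, of T] bij assms(6) unfolding T_def bij_betw_def by auto
  have bijT': "bij_betw ((!) vs) T' ?V"
    using bij_betw_subset[OF bij, of T'] bij unfolding T'_def bij_betw_def by auto
  have TT: "T \<subseteq> {..<n}" "T' \<subseteq> {..<n}" "T \<inter> T' = {}" unfolding T_def T'_def by auto
  have finT: "finite T" "finite T'" using TT finite_subset by blast+
  have cardT: "card T = m" using bij_betw_same_card[OF bijT] assms(7) by simp
  have cardT': "card T' = n - m"
    using bij_betw_same_card[OF bijT'] assms(3,6,7) by (simp add: card_Diff_subset finite_subset[OF assms(6)])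
  have carr: "?A \<in> carrier_mat n n"
    unfolding signless_laplacian_def degree_mat_def adjacency_mat_def by (auto simp: len)
  have Aab: "?A $$ (a, b) = (if a = b then real (out_degree G (vs ! a)) else 0)
      + (if (vs ! a, vs ! b) \<in> arcs_ends G then 1 else 0)" if "a < n" "b < n" for a b
    using signless_laplacian_index[OF assms(4)] that len by metis
  have sym: "transpose_mat ?A = ?A"
    by (rule eq_matI) (use carr graph_symmetric in \<open>auto simp: Aab\<close>)
  \<comment> \<open>This factor gives the indicator vector of the \<open>n - m\<close> positions in
    \<open>T'\<close> norm 1.\<close>
  define c where "c = 1 / sqrt (real n - real m)"
  have c2: "c * c = 1 / (real n - real m)" unfolding c_def using assms(9) by simp
  \<comment> \<open>\<open>Some j\<close> labels the standard basis vector at position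
    \<open>j\<close>, and \<open>None\<close> labels the one extra vector, the normalised indicator
    of \<open>T'\<close>.\<close>
  define x :: "nat option \<Rightarrow> nat \<Rightarrow> real" where
    "x i a = (case i of Some j \<Rightarrow> if a = j then 1 else 0 | None \<Rightarrow> if a \<in> T' then c else 0)" for i a
  define I where "I = insert None (Some ` T)"
  have finI: "finite I" unfolding I_def using finT by simp
  have cardI: "card I = m + 1"
    unfolding I_def using finT by (simp add: card_image cardT)
  have sum_T': "(\<Sum>a<n. if a \<in> T' then h a else 0) = (\<Sum>a\<in>T'. h a)" for h :: "nat \<Rightarrow> real"
    using TT by (simp add: sum.If_cases Int_absorb1)
  have orth: "(\<Sum>a<n. x i a * x j a) = (if i = j then 1 else 0)" if "i \<in> I" "j \<in> I" for i j
  proof -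
    have nn: "(\<Sum>a<n. x None a * x None a) = 1"
    proof -
      have "(\<Sum>a<n. x None a * x None a) = (\<Sum>a<n. if a \<in> T' then c * c else 0)"
        by (intro sum.cong) (auto simp: x_def)
      also have "\<dots> = real (n - m) * (c * c)" by (subst sum_T') (simp add: cardT')
      finally show ?thesis using assms(9) by (simp add: c2 of_nat_diff)
    qed
    have sn: "(\<Sum>a<n. x (Some k) a * f a) = f k" if "k \<in> T" for k and f :: "nat \<Rightarrow> real"
    proof -
      have "(\<Sum>a<n. x (Some k) a * f a) = (\<Sum>a<n. if a = k then f k else 0)"
        by (intro sum.cong) (auto simp: x_def)
      then show ?thesis using that TT by auto
    qed
    have ns: "(\<Sum>a<n. f a * x (Some k) a) = f k" if "k \<in> T" for k and f :: "nat \<Rightarrow> real"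
      using sn[OF that, of f] by (simp add: mult.commute)
    have xv: "x (Some l) k = (if k = l then 1 else 0)" "k \<in> T \<Longrightarrow> x None k = 0" for k l
      using TT by (auto simp: x_def)
    show ?thesis
      using that by (cases i; cases j) (auto simp: I_def nn sn ns xv(2), simp_all add: xv(1))
  qed
  let ?q = "\<lambda>i. \<Sum>a<n. \<Sum>b<n. ?A $$ (a, b) * x i a * x i b"
  have qSome: "?q (Some i) = real (out_degree G (vs ! i))" if "i \<in> T" for i
  proof -
    have i: "i < n" using that TT by auto
    have "?q (Some i) = (\<Sum>a<n. \<Sum>b<n. if b = i then (if a = i then ?A $$ (i, i) else 0) else 0)"
      by (intro sum.cong) (auto simp: x_def)
    also have "\<dots> = ?A $$ (i, i)" using i by simp
    \<comment> \<open>Without loops, the adjacency part contributes nothing to a diagonal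
      entry.\<close>
    finally show ?thesis using i adj_not_same by (auto simp: Aab)
  qed
  have qNone: "?q None = ((\<Sum>u\<in>?V. real (out_degree G u)) + 2 * real (card (edges_within G ?V))) / (real n - real m)"
  proof -
    \<comment> \<open>The vector vanishes outside \<open>T'\<close> and equals \<open>c\<close>
      there, so the form is \<open>c * c\<close> times the sum of the entries of the block on
      \<open>T'\<close>, which splits into degrees and adjacencies.\<close>
    have "?q None = (\<Sum>a<n. if a \<in> T' then (\<Sum>b<n. if b \<in> T' then c * c * ?A $$ (a, b) else 0) else 0)"
      by (intro sum.cong) (auto simp: x_def intro!: sum.cong)
    also have "\<dots> = c * c * (\<Sum>a\<in>T'. \<Sum>b\<in>T'. ?A $$ (a, b))"
      unfolding sum_T' by (simp add: sum_distrib_left)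
    also have "(\<Sum>a\<in>T'. \<Sum>b\<in>T'. ?A $$ (a, b)) = (\<Sum>a\<in>T'. real (out_degree G (vs ! a)))
        + (\<Sum>a\<in>T'. \<Sum>b\<in>T'. if (vs ! a, vs ! b) \<in> arcs_ends G then 1 else 0)"
      unfolding sum.distrib[symmetric]
    proof (intro sum.cong refl)
      fix a assume a: "a \<in> T'"
      have "(\<Sum>b\<in>T'. ?A $$ (a, b)) = (\<Sum>b\<in>T'. (if a = b then real (out_degree G (vs ! a)) else 0)
          + (if (vs ! a, vs ! b) \<in> arcs_ends G then 1 else 0))"
        using a TT by (intro sum.cong refl Aab) auto
      then show "(\<Sum>b\<in>T'. ?A $$ (a, b)) = real (out_degree G (vs ! a))
          + (\<Sum>b\<in>T'. if (vs ! a, vs ! b) \<in> arcs_ends G then 1 else 0)"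
        using a finT by (simp add: sum.distrib)
    qed
    also have "(\<Sum>a\<in>T'. real (out_degree G (vs ! a))) = (\<Sum>u\<in>?V. real (out_degree G u))"
      by (rule sum.reindex_bij_betw[OF bijT'])
    \<comment> \<open>The double sum is carried from positions to vertices one index at a time and
      then counts ordered adjacent pairs, that is, each edge twice.\<close>
    also have "(\<Sum>a\<in>T'. \<Sum>b\<in>T'. if (vs ! a, vs ! b) \<in> arcs_ends G then 1 else (0::real))
        = (\<Sum>a\<in>T'. \<Sum>w\<in>?V. if (vs ! a, w) \<in> arcs_ends G then 1 else 0)"
      by (intro sum.cong refl sum.reindex_bij_betw[OF bijT'])
    also have "\<dots> = (\<Sum>u\<in>?V. \<Sum>w\<in>?V. if (u, w) \<in> arcs_ends G then 1 else 0)"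
      by (rule sum.reindex_bij_betw[OF bijT'])
    also have "\<dots> = (\<Sum>p\<in>?V \<times> ?V. if p \<in> arcs_ends G then 1 else 0)"
      by (simp add: sum.cartesian_product)
    also have "\<dots> = real (card {p \<in> ?V \<times> ?V. p \<in> arcs_ends G})"
      by (simp add: sum.If_cases Int_def)
    finally show ?thesis by (simp add: c2 card_adjacent_pairs)
  qed
  have "(\<Sum>i\<in>I. ?q i) = ?q None + (\<Sum>i\<in>T. ?q (Some i))"
    unfolding I_def using finT by (subst sum.insert) (auto simp: sum.reindex)
  also have "(\<Sum>i\<in>T. ?q (Some i)) = (\<Sum>i\<in>T. real (out_degree G (vs ! i)))"
    by (intro sum.cong refl qSome)
  also have "\<dots> = (\<Sum>u\<in>U. real (out_degree G u))"
    by (rule sum.reindex_bij_betw[OF bijT])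
  finally have q: "(\<Sum>i\<in>I. ?q i) = (\<Sum>u\<in>U. real (out_degree G u))
      + ((\<Sum>u\<in>?V. real (out_degree G u)) + 2 * real (card (edges_within G ?V))) / (real n - real m)"
    unfolding qNone by simp
  \<comment> \<open>\<open>q_eig\<close> counts from 1 and lists count from 0, so \<open>i\<close>
    corresponds to \<open>l + 1\<close>; in the sum of the smallest eigenvalues below,
    \<open>n - i + 1\<close> becomes list index \<open>n - 1 - l\<close>.\<close>
  have "(\<Sum>i = 1..m + 1. q_eig G vs i) = (\<Sum>l<m + 1. eigenvalues_desc ?A ! l)"
    by (rule sum.reindex_bij_witness[where i = "\<lambda>l. l + 1" and j = "\<lambda>i. i - 1"]) (auto simp: q_eig_def)
  moreover have "(\<Sum>i = 1..m + 1. q_eig G vs (n - i + 1)) = (\<Sum>l<m + 1. eigenvalues_desc ?A ! (n - 1 - l))"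
    by (rule sum.reindex_bij_witness[where i = "\<lambda>l. l + 1" and j = "\<lambda>i. i - 1"]) (auto simp: q_eig_def)
  ultimately show ?thesis
    using ky_fan[OF carr sym finI orth] unfolding q cardI by simp
qed

end
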